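(* Let $G$ be a block graph on $n$ vertices. Then $c_G(\mathfrak m)=2n-b(G)$.
   Context: Let $G$ be a finite simple graph on the vertex set $[n]=\{1,\dots,n\}$, let $K$ be a field, $S=K[x_1,\dots,x_n,y_1,\dots,y_n]$ and $\mathfrak m=(x_1,\dots,x_n,y_1,\dots,y_n)$. The binomial edge ideal of $G$ is $J_G=(x_iy_j-x_jy_i : \{i,j\}\in E(G))\subset S$. For a positive integer $k$ put $\mathfrak m^{[k]}=(x_1^k,\dots,x_n^k,y_1^k,\dots,y_n^k)$, $(\mathfrak m^{[k]},J_G)=\mathfrak m^{[k]}+J_G$, $v_G(k)=\max\{r\in\mathbb N : \mathfrak m^r\not\subseteq(\mathfrak m^{[k]},J_G)\}$, and $c_G(\mathfrak m)=\lim_{k\to\infty} v_G(k)/k$ (the diagonal $F$-threshold of $S/J_G$). A block graph is a graph in which every block (maximal connected subgraph without cutpoints) is a complete graph. A clique matching of $G$ is a (possibly empty) set $Q$ of pairwise vertex-disjoint cliques of $G$, each having at least $2$ vertices; $V(Q)$ is the union of the vertex sets of its cliques. Set $b(G)=\max\{|V(Q)| : Q \text{ a clique matching of } G\}$. *)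

theory Defs
  imports Complex_Main "HOL-Library.Poly_Mapping" "HOL-Library.Cardinality" "HOL-Library.Disjoint_Sets" "HOL-Library.Ramsey"
begin

section \<open>Graphs\<close>

text \<open>A graph is given by a vertex set \<open>V\<close> and a set \<open>E\<close> of two-element subsets of \<open>V\<close>.\<close>

definition simple_graph :: "'v set \<Rightarrow> 'v set set \<Rightarrow> bool" where
  "simple_graph V E \<longleftrightarrow> finite V \<and> (\<forall>e\<in>E. e \<subseteq> V \<and> card e = 2)"

definition subgraph :: "'v set \<Rightarrow> 'v set set \<Rightarrow> 'v set \<Rightarrow> 'v set set \<Rightarrow> bool" where
  "subgraph W F V E \<longleftrightarrow> simple_graph W F \<and> W \<subseteq> V \<and> F \<subseteq> E"

definition joined :: "'v set \<Rightarrow> 'v set set \<Rightarrow> ('v \<times> 'v) set" where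
  "joined V E = {(u, w). u \<in> V \<and> w \<in> V \<and> (u, w) \<in> {(a, b). {a, b} \<in> E}\<^sup>*}"

definition components :: "'v set \<Rightarrow> 'v set set \<Rightarrow> 'v set set" where
  "components V E = V // joined V E"

text \<open>By convention a connected graph has at least one vertex.\<close>

definition connected_graph :: "'v set \<Rightarrow> 'v set set \<Rightarrow> bool" where
  "connected_graph V E \<longleftrightarrow> V \<noteq> {} \<and> (\<forall>u\<in>V. \<forall>w\<in>V. (u, w) \<in> joined V E)"

text \<open>A cutpoint is a vertex whose deletion increases the number of connected components.
  In particular, the only vertex of a one-vertex graph is not a cutpoint.\<close>

definition cutpoint :: "'v set \<Rightarrow> 'v set set \<Rightarrow> 'v \<Rightarrow> bool" where
  "cutpoint V E v \<longleftrightarrow>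
     v \<in> V \<and> card (components (V - {v}) {e \<in> E. v \<notin> e}) > card (components V E)"

definition connected_without_cutpoints :: "'v set \<Rightarrow> 'v set set \<Rightarrow> bool" where
  "connected_without_cutpoints V E \<longleftrightarrow> connected_graph V E \<and> (\<forall>v. \<not> cutpoint V E v)"

text \<open>Cutpoints are those of the subgraph itself, not those of the ambient graph.\<close>

definition block :: "'v set \<Rightarrow> 'v set set \<Rightarrow> 'v set \<Rightarrow> 'v set set \<Rightarrow> bool" where
  "block V E W F \<longleftrightarrow>
     subgraph W F V E \<and> connected_without_cutpoints W F \<and>
     (\<forall>W' F'. subgraph W' F' V E \<and> connected_without_cutpoints W' F' \<and> subgraph W F W' F'
        \<longrightarrow> W' = W \<and> F' = F)"

definition complete_graph :: "'v set \<Rightarrow> 'v set set \<Rightarrow> bool" where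
  "complete_graph V E \<longleftrightarrow> E = {e. e \<subseteq> V \<and> card e = 2}"

definition block_graph :: "'v set \<Rightarrow> 'v set set \<Rightarrow> bool" where
  "block_graph V E \<longleftrightarrow>
     simple_graph V E \<and> (\<forall>W F. block V E W F \<longrightarrow> complete_graph W F)"

definition clique_matching :: "'v set \<Rightarrow> 'v set set \<Rightarrow> 'v set set \<Rightarrow> bool" where
  "clique_matching V E Q \<longleftrightarrow>
     (\<forall>C\<in>Q. C \<subseteq> V \<and> clique C E \<and> card C \<ge> 2) \<and> disjoint Q"

definition clique_matching_number :: "'v set \<Rightarrow> 'v set set \<Rightarrow> nat" where
  "clique_matching_number V E = Max {card (\<Union>Q) | Q. clique_matching V E Q}"


section \<open>The polynomial ring and its ideals\<close>

text \<open>The vertices are the elements of a finite type \<open>'v\<close>, which plays the role of the set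
  of labels from \<open>1\<close> to \<open>n\<close> with \<open>n = CARD('v)\<close>. Then \<open>('v, 'k) mpoly\<close> is the whole polynomial
  ring over \<open>'k\<close> in the \<open>2 * n\<close> variables \<open>X i\<close>, \<open>Y i\<close>, an element being a finitely supported
  family of coefficients indexed by exponent vectors.\<close>

datatype 'v var = X 'v | Y 'v

type_synonym ('v, 'k) mpoly = "('v var \<Rightarrow>\<^sub>0 nat) \<Rightarrow>\<^sub>0 'k"

definition var :: "'v var \<Rightarrow> ('v, 'k::field) mpoly" where
  "var z = Poly_Mapping.single (Poly_Mapping.single z 1) 1"

text \<open>The ideal generated by a set is its span in the ring regarded as a module over itself.\<close>

definition ideal :: "'a::comm_ring_1 set \<Rightarrow> 'a set" where
  "ideal A = module.span (*) A"

primrec ideal_power :: "'a::comm_ring_1 set \<Rightarrow> nat \<Rightarrow> 'a set" where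
  "ideal_power I 0 = UNIV"
| "ideal_power I (Suc r) = ideal {a * b | a b. a \<in> I \<and> b \<in> ideal_power I r}"

definition ideal_sum :: "'a::comm_ring_1 set \<Rightarrow> 'a set \<Rightarrow> 'a set" where
  "ideal_sum I J = {a + b | a b. a \<in> I \<and> b \<in> J}"

definition max_ideal :: "('v, 'k::field) mpoly set" where
  "max_ideal = ideal (range var)"

definition frobenius_power :: "nat \<Rightarrow> ('v, 'k::field) mpoly set" where
  "frobenius_power k = ideal (range (\<lambda>z. var z ^ k))"

text \<open>An edge contributes both \<open>x\<^sub>i y\<^sub>j - x\<^sub>j y\<^sub>i\<close> and its negative.\<close>

definition binomial_edge_ideal :: "'v set set \<Rightarrow> ('v, 'k::field) mpoly set" where
  "binomial_edge_ideal E =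
     ideal {var (X i) * var (Y j) - var (X j) * var (Y i) | i j. {i, j} \<in> E}"


section \<open>The diagonal F-threshold\<close>

text \<open>For \<open>k \<ge> 1\<close> the set below is finite and contains \<open>0\<close>; only the limit over \<open>k\<close> matters,
  so the value at \<open>k = 0\<close>, where the set is empty, is irrelevant. The type argument fixes the
  coefficient field.\<close>

definition v_number :: "'k::field itself \<Rightarrow> 'v set set \<Rightarrow> nat \<Rightarrow> nat" where
  "v_number K E k =
     Max {r. \<not> ideal_power (max_ideal :: ('v, 'k) mpoly set) r
               \<subseteq> ideal_sum (frobenius_power k) (binomial_edge_ideal E)}"

definition diagonal_F_threshold :: "'k::field itself \<Rightarrow> 'v set set \<Rightarrow> real" where
  "diagonal_F_threshold K E = lim (\<lambda>k. real (v_number K E k) / real k)"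

end

theory Submission
  imports Defs
begin

text \<open>Modulo the binomials, monomials form classes under moves that exchange an \<open>x\<close> at one end of an
  edge for a \<open>y\<close> at the other end, so \<open>v\<^sub>G(k)\<close> is the largest degree of a monomial whose class
  contains only monomials with all exponents below \<open>k\<close>. On a clique with \<open>m \<ge> 2\<close> vertices all
  \<open>x\<close>'s can be gathered on one vertex, which bounds the degree there by \<open>m (k - 1)\<close>, while each
  remaining vertex carries at most \<open>2 (k - 1)\<close>. Hence \<open>v\<^sub>G(k) \<le> (2 n - b(G)) (k - 1)\<close> for every graph.

  Conversely, let \<open>I\<close> be an independent set with neighbourhood \<open>N\<close>. Exponents \<open>k - 1\<close> for both
  variables on \<open>I\<close>, zero on \<open>N\<close> and total degree \<open>k - 1\<close> at the other vertices are preserved by all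
  moves, and give degree \<open>(n + |I| - |N|) (k - 1)\<close>. By Hall's theorem the maximum of \<open>|I| - |N|\<close> is
  \<open>n - |D|\<close> for some injection \<open>f\<close> on a set \<open>D\<close> moving every vertex along an edge. The functional graph
  of \<open>f\<close> splits into paths, which are covered by single edges up to one vertex not in \<open>D\<close>, and cycles,
  which are cliques in a block graph, so \<open>b(G) \<ge> |D|\<close> and the two bounds agree.\<close>


section \<open>Hall's theorem\<close>

text \<open>Rado's argument: as long as some \<open>N a\<close> has two elements, one of them can be removed.\<close>

lemma hall:
  fixes N :: "'a \<Rightarrow> 'b set"
  assumes "finite A" and "\<And>a. a \<in> A \<Longrightarrow> finite (N a)"
    and "\<And>B. B \<subseteq> A \<Longrightarrow> card B \<le> card (\<Union>(N ` B))"
  shows "\<exists>f. inj_on f A \<and> (\<forall>a\<in>A. f a \<in> N a)"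
  using assms
proof (induction "\<Sum>a\<in>A. card (N a)" arbitrary: N rule: less_induct)
  case less
  show ?case
  proof (cases "\<forall>a\<in>A. card (N a) \<le> 1")
    case True
    have "card (N a) = 1" if "a \<in> A" for a
      using less.prems(3)[of "{a}"] that True by force
    then have "\<forall>a\<in>A. \<exists>x. N a = {x}"
      by (simp add: card_1_singleton_iff)
    then obtain f where f: "\<And>a. a \<in> A \<Longrightarrow> N a = {f a}"
      by metis
    have "inj_on f A"
    proof (rule inj_onI, rule ccontr)
      fix a b assume ab: "a \<in> A" "b \<in> A" "f a = f b" "a \<noteq> b"
      then have "\<Union>(N ` {a, b}) = {f a}"
        using f by auto
      with less.prems(3)[of "{a, b}"] ab show False
        by simp
    qed
    with f show ?thesis
      by blast
  next
    case False
    then obtain a where a: "a \<in> A" "card (N a) > 1"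
      by (auto simp: not_le)
    then obtain x y where xy: "x \<in> N a" "y \<in> N a" "x \<noteq> y"
      using card_le_Suc0_iff_eq[OF less.prems(2)[OF a(1)]] by auto
    define N' where "N' z = N(a := N a - {z})" for z
    have dec: "(\<Sum>a\<in>A. card (N' z a)) < (\<Sum>a\<in>A. card (N a))" if "z \<in> N a" for z
    proof (rule sum_strict_mono_ex1)
      show "\<forall>b\<in>A. card (N' z b) \<le> card (N b)"
        using less.prems(2) by (auto simp: N'_def intro: card_mono)
      show "\<exists>b\<in>A. card (N' z b) < card (N b)"
        using a that less.prems(2) by (intro bexI[of _ a]) (simp_all add: N'_def card_Diff1_less)
    qed (use less.prems in simp)
    have fin: "finite (N' z b)" if "b \<in> A" for z b
      using less.prems(2) that a(1) by (simp add: N'_def)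
    have sub: "N' z b \<subseteq> N b" for z b
      by (auto simp: N'_def)
    have ok: ?thesis if "z \<in> N a" "\<And>B. B \<subseteq> A \<Longrightarrow> card B \<le> card (\<Union>(N' z ` B))" for z
      using less.hyps[OF dec[OF that(1)] less.prems(1) fin that(2)] sub by blast
    \<comment> \<open>A set that violates Hall's condition after the removal must contain
      \<open>a\<close>. Writing it as \<open>insert a B\<close> turns the strict inequality into
      \<open>\<le> card B\<close>.\<close>
    have bad: "\<exists>B\<subseteq>A - {a}. card (\<Union>(N' z ` insert a B)) \<le> card B"
      if "B \<subseteq> A" "\<not> card B \<le> card (\<Union>(N' z ` B))" for z B
    proof -
      have "a \<in> B"
      proof (rule ccontr)
        assume "a \<notin> B"
        then have "N' z ` B = N ` B"
          by (auto simp: N'_def)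
        with that less.prems(3) show False
          by simp
      qed
      moreover have "finite B"
        using that less.prems(1) finite_subset by blast
      ultimately show ?thesis
        using that(1,2) by (intro exI[of _ "B - {a}"]) (simp add: insert_absorb card_Diff_singleton Diff_mono)
    qed
    show ?thesis
    proof (rule ccontr)
      assume neg: "\<not> ?thesis"
      have viol: "\<exists>B\<subseteq>A - {a}. card (\<Union>(N' z ` insert a B)) \<le> card B" if "z \<in> N a" for z
      proof (rule ccontr)
        assume "\<not> ?thesis"
        then have "\<And>B. B \<subseteq> A \<Longrightarrow> card B \<le> card (\<Union>(N' z ` B))"
          using bad[of _ z] by blast
        then show False
          using ok[OF that] neg by blast
      qed
      obtain B where B: "B \<subseteq> A - {a}" "card (\<Union>(N' x ` insert a B)) \<le> card B"
        using viol[OF xy(1)] by blast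
      obtain C where C: "C \<subseteq> A - {a}" "card (\<Union>(N' y ` insert a C)) \<le> card C"
        using viol[OF xy(2)] by blast
      have un: "\<Union>(N' z ` insert a B) = (N a - {z}) \<union> \<Union>(N ` B)" if "B \<subseteq> A - {a}" for z B
      proof -
        have "N' z ` B = N ` B"
          using that by (intro image_cong) (auto simp: N'_def)
        then have "\<Union>(N' z ` insert a B) = N' z a \<union> \<Union>(N ` B)"
          by (simp only: image_insert Union_insert)
        then show ?thesis
          by (simp only: N'_def fun_upd_same)
      qed
      let ?U = "\<Union>(N' x ` insert a B)" and ?W = "\<Union>(N' y ` insert a C)"
      have fB: "finite B" "finite C"
        using B C less.prems(1) finite_subset by blast+
      have fU: "finite ?U" "finite ?W"
        using B(1) C(1) a fin fB by (intro finite_UN_I; auto)+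
      \<comment> \<open>Since \<open>x \<noteq> y\<close>, the two reduced copies of
        \<open>N a\<close> together give back \<open>N a\<close>. Hall's condition for
        \<open>insert a (B \<union> C)\<close> and for \<open>B \<inter> C\<close> then forces
        \<open>card ?U + card ?W \<ge> card B + card C + 1\<close>, against the choice of
        \<open>B\<close> and \<open>C\<close>.\<close>
      have "\<Union>(N ` insert a (B \<union> C)) = ?U \<union> ?W"
        unfolding un[OF B(1)] un[OF C(1)] using xy by auto
      moreover have "\<Union>(N ` (B \<inter> C)) \<subseteq> ?U \<inter> ?W"
        unfolding un[OF B(1)] un[OF C(1)] by auto
      moreover have "card (insert a (B \<union> C)) \<le> card (\<Union>(N ` insert a (B \<union> C)))"
        using less.prems(3)[of "insert a (B \<union> C)"] B C a by blast
      moreover have "card (B \<inter> C) \<le> card (\<Union>(N ` (B \<inter> C)))"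
        using less.prems(3)[of "B \<inter> C"] B by blast
      moreover have "card (insert a (B \<union> C)) = Suc (card (B \<union> C))"
        using fB B C by (subst card_insert_disjoint) auto
      ultimately have "Suc (card (B \<union> C)) \<le> card (?U \<union> ?W)" "card (B \<inter> C) \<le> card (?U \<inter> ?W)"
        using card_mono[of "?U \<inter> ?W" "\<Union>(N ` (B \<inter> C))"] fU by auto
      then show False
        using B(2) C(2) card_Un_Int[OF fU] card_Un_Int[OF fB] by linarith
    qed
  qed
qed

text \<open>Hall's theorem after adding as many dummy values as the largest deficiency.\<close>

lemma hall_deficiency:
  fixes N :: "'a \<Rightarrow> 'b set"
  assumes "finite A" and "\<And>a. a \<in> A \<Longrightarrow> finite (N a)"
  shows "\<exists>f D B. D \<subseteq> A \<and> inj_on f D \<and> (\<forall>a\<in>D. f a \<in> N a) \<and> B \<subseteq> A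
    \<and> card A + card (\<Union>(N ` B)) \<le> card B + card D"
proof -
  define defi where "defi B = card B - card (\<Union>(N ` B))" for B
  have "defi C < Suc (card A)" if "C \<subseteq> A" for C
    using card_mono[OF assms(1) that] by (simp add: defi_def)
  then obtain B where B: "B \<subseteq> A" "\<And>C. C \<subseteq> A \<Longrightarrow> defi C \<le> defi B"
    using Lattices_Big.ex_has_greatest_nat[of "\<lambda>B. B \<subseteq> A" "{}" defi "Suc (card A)"]
    by blast
  define d where "d = defi B"
  define N' :: "'a \<Rightarrow> ('b + nat) set" where "N' a = Inl ` N a \<union> Inr ` {..<d}" for a
  have "\<exists>f. inj_on f A \<and> (\<forall>a\<in>A. f a \<in> N' a)"
  proof (rule hall)
    fix C assume C: "C \<subseteq> A"
    have fin: "finite (\<Union>(N ` C))"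
      using C assms by (auto intro: finite_subset)
    show "card C \<le> card (\<Union>(N' ` C))"
    proof (cases "C = {}")
      case False
      then have "\<Union>(N' ` C) = (\<Union>(N ` C)) <+> {..<d}"
        by (auto simp: N'_def Plus_def)
      then have "card (\<Union>(N' ` C)) = card (\<Union>(N ` C)) + d"
        using fin by (simp add: card_Plus)
      then show ?thesis
        using B(2)[OF C] by (simp add: d_def defi_def)
    qed simp
  qed (use assms in \<open>auto simp: N'_def\<close>)
  then obtain f where f: "inj_on f A" "\<And>a. a \<in> A \<Longrightarrow> f a \<in> N' a"
    by blast
  \<comment> \<open>Values of the form \<open>Inr\<close> are dummies. At most \<open>d\<close>
    elements of \<open>A\<close> receive one; the others form \<open>D\<close>.\<close>
  define D where "D = {a \<in> A. f a \<in> range Inl}"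
  have "D \<subseteq> A"
    by (auto simp: D_def)
  have "f ` (A - D) \<subseteq> Inr ` {..<d}"
    using f(2) by (fastforce simp: D_def N'_def)
  then have "card (A - D) \<le> card (Inr ` {..<d} :: ('b + nat) set)"
    using card_mono[of "Inr ` {..<d}" "f ` (A - D)"] card_image[OF inj_on_subset[OF f(1) Diff_subset]] by simp
  then have "card (A - D) \<le> d"
    by (simp add: card_image)
  moreover have "card (A - D) = card A - card D" "card D \<le> card A"
    using assms(1) \<open>D \<subseteq> A\<close> by (simp_all add: card_Diff_subset finite_subset card_mono)
  moreover have "\<forall>a\<in>D. (projl \<circ> f) a \<in> N a"
    using f(2) by (fastforce simp: D_def N'_def)
  moreover have "inj_on (projl \<circ> f) D"
  proof (rule inj_onI)
    fix a b assume ab: "a \<in> D" "b \<in> D" "(projl \<circ> f) a = (projl \<circ> f) b"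
    then have "f a = f b"
      by (auto simp: D_def)
    with ab(1,2) f(1) \<open>D \<subseteq> A\<close> show "a = b"
      by (meson inj_onD subsetD)
  qed
  ultimately show ?thesis
  proof (cases "d = 0")
    \<comment> \<open>For \<open>d = 0\<close> truncated subtraction hides how far
      \<open>card B\<close> may fall below the size of its neighbourhood, so the empty set replaces
      \<open>B\<close>.\<close>
    case True
    then have "card A \<le> card D"
      using \<open>card (A - D) \<le> d\<close> \<open>card (A - D) = _\<close> by simp
    with \<open>D \<subseteq> A\<close> \<open>inj_on (projl \<circ> f) D\<close> \<open>\<forall>a\<in>D. (projl \<circ> f) a \<in> N a\<close> show ?thesis
      by (intro exI[of _ "projl \<circ> f"] exI[of _ D] exI[of _ "{}"]) simp
  next
    case False
    then have "d + card (\<Union>(N ` B)) = card B"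
      by (simp add: d_def defi_def)
    with \<open>card (A - D) \<le> d\<close> \<open>card (A - D) = _\<close> \<open>card D \<le> card A\<close> \<open>D \<subseteq> A\<close> B(1)
      \<open>inj_on (projl \<circ> f) D\<close> \<open>\<forall>a\<in>D. (projl \<circ> f) a \<in> N a\<close> show ?thesis
      by (intro exI[of _ "projl \<circ> f"] exI[of _ D] exI[of _ B]) simp
  qed
qed

section \<open>Cycles in block graphs\<close>

text \<open>By finiteness there is a connected subgraph without cutpoints that contains the given
  one and has the most vertices and edges in total. It is a block, hence complete, so any two
  vertices of \<open>W\<close> are adjacent.\<close>

lemma block_graph_clique:
  assumes bg: "block_graph V E" and sub: "subgraph W F V E" and con: "connected_without_cutpoints W F"
  shows "clique W E"
proof -
  define P where "P = {(W', F'). subgraph W' F' V E \<and> connected_without_cutpoints W' F' \<and> subgraph W F W' F'}"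
  have "finite V" and E: "E \<subseteq> Pow V"
    using bg by (auto simp: block_graph_def simple_graph_def)
  then have "finite (Pow V \<times> Pow E)"
    by (meson finite_Pow_iff finite_SigmaI finite_subset)
  moreover have "P \<subseteq> Pow V \<times> Pow E"
    by (auto simp: P_def subgraph_def)
  ultimately have finP: "finite P"
    using finite_subset by blast
  have "(W, F) \<in> P"
    using sub con by (auto simp: P_def subgraph_def)
  define c where "c = (\<lambda>(W' :: 'a set, F' :: 'a set set). card W' + card F')"
  have "Max (c ` P) \<in> c ` P"
    using finP \<open>(W, F) \<in> P\<close> by (intro Max_in) auto
  then obtain W' F' where "(W', F') \<in> P" "c (W', F') = Max (c ` P)"
    by auto
  then have m: "(W', F') \<in> P" "\<And>p. p \<in> P \<Longrightarrow> c p \<le> c (W', F')"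
    using finP by auto
  have "block V E W' F'"
    unfolding block_def
  proof (intro conjI allI impI)
    fix W2 F2 assume *: "subgraph W2 F2 V E \<and> connected_without_cutpoints W2 F2 \<and> subgraph W' F' W2 F2"
    then have le: "W' \<subseteq> W2" "F' \<subseteq> F2"
      by (auto simp: subgraph_def)
    have "W \<subseteq> W'" "F \<subseteq> F'"
      using m(1) by (auto simp: P_def subgraph_def)
    with * le have "(W2, F2) \<in> P"
      using sub by (auto simp: P_def subgraph_def)
    then have c: "card W2 + card F2 \<le> card W' + card F'"
      using m(2)[of "(W2, F2)"] by (simp add: c_def)
    have fin: "finite W2" "finite F2"
      using * \<open>finite V\<close> E by (auto simp: subgraph_def intro: finite_subset[of _ V] finite_subset[of _ "Pow V"])
    then have "card W' \<le> card W2" "card F' \<le> card F2"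
      using le by (auto intro: card_mono)
    with c have "card W' = card W2" "card F' = card F2"
      by auto
    with fin le show "W2 = W'" "F2 = F'"
      using card_subset_eq by blast+
  qed (use m(1) in \<open>auto simp: P_def\<close>)
  then have "F' = {e. e \<subseteq> W' \<and> card e = 2}"
    using bg by (auto simp: block_graph_def complete_graph_def)
  moreover have "F' \<subseteq> E" "W \<subseteq> W'"
    using m(1) by (auto simp: P_def subgraph_def)
  moreover have "{v, w} \<in> F'" if "v \<in> W'" "w \<in> W'" "v \<noteq> w" for v w
    using that calculation(1) by simp
  ultimately show ?thesis
    unfolding clique_def by blast
qed

lemma card_components_connected:
  assumes "\<And>u w. u \<in> V \<Longrightarrow> w \<in> V \<Longrightarrow> (u, w) \<in> joined V E"
  shows "card (components V E) \<le> 1"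
proof -
  have "joined V E `` {u} = V" if "u \<in> V" for u
    using assms that by (auto simp: joined_def)
  then have "components V E \<subseteq> {V}"
    by (auto simp: components_def quotient_def)
  then show ?thesis
    using card_mono[of "{V}" "components V E"] by simp
qed

text \<open>The edges \<open>{w, f w}\<close> form a cycle, or a single edge, through all of
  \<open>W\<close>. Deleting a vertex leaves a path, so there is no cutpoint and the previous facts
  on blocks apply.\<close>

lemma cycle_clique:
  fixes f :: "'v \<Rightarrow> 'v"
  assumes bg: "block_graph V E" and "W \<subseteq> V" "W \<noteq> {}"
    and edge: "\<And>w. w \<in> W \<Longrightarrow> {w, f w} \<in> E" and cl: "\<And>w. w \<in> W \<Longrightarrow> f w \<in> W"
    and trans: "\<And>x y. x \<in> W \<Longrightarrow> y \<in> W \<Longrightarrow> \<exists>t. y = (f ^^ t) x"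
  shows "clique W E"
proof (rule block_graph_clique[OF bg])
  define F where "F = (\<lambda>w. {w, f w}) ` W"
  have finV: "finite V" and card2: "\<And>e. e \<in> E \<Longrightarrow> card e = 2"
    using bg by (auto simp: block_graph_def simple_graph_def)
  have finW: "finite W"
    using finV \<open>W \<subseteq> V\<close> finite_subset by blast
  show "subgraph W F V E"
    using finW \<open>W \<subseteq> V\<close> cl edge card2 by (auto simp: subgraph_def simple_graph_def F_def)
  have it: "(f ^^ t) x \<in> W" if "x \<in> W" for x t
    using that cl by (induction t) auto
  have "(x, (f ^^ t) x) \<in> {(a, b). {a, b} \<in> F}\<^sup>*" if "x \<in> W" for x t
  proof (induction t)
    case (Suc t)
    have "{(f ^^ t) x, (f ^^ Suc t) x} \<in> F"
      using it[OF that] by (auto simp: F_def)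
    with Suc show ?case
      by (auto intro: rtrancl_into_rtrancl)
  qed simp
  then have conW: "connected_graph W F"
    using trans \<open>W \<noteq> {}\<close> unfolding connected_graph_def joined_def by force
  then have ne: "card (components W F) \<ge> 1"
    using finW by (auto simp: components_def joined_def card_gt_0_iff Suc_le_eq quotient_def connected_graph_def)
  have cut: "\<not> cutpoint W F x" for x
  proof
    assume "cutpoint W F x"
    then have x: "x \<in> W" and gt: "card (components (W - {x}) {e \<in> F. x \<notin> e}) > card (components W F)"
      by (auto simp: cutpoint_def)
    let ?R = "{(a, b). {a, b} \<in> {e \<in> F. x \<notin> e}}"
    \<comment> \<open>Walking along \<open>f\<close> from \<open>f x\<close> reaches
      \<open>y\<close> before coming back to the deleted vertex \<open>x\<close>.\<close>
    have reach: "(f x, y) \<in> ?R\<^sup>*" if y: "y \<in> W - {x}" for y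
    proof -
      have "\<exists>t. y = (f ^^ t) x"
        using trans x y by blast
      define t where "t = (LEAST t. y = (f ^^ t) x)"
      have t: "y = (f ^^ t) x"
        unfolding t_def using \<open>\<exists>t. y = (f ^^ t) x\<close> by (rule LeastI_ex)
      have least: "y \<noteq> (f ^^ s) x" if "s < t" for s
        using not_less_Least that unfolding t_def by blast
      \<comment> \<open>A return to \<open>x\<close> after \<open>s\<close> steps would let
        \<open>y\<close> be reached already in \<open>t - s\<close> steps, against the minimality of
        \<open>t\<close>.\<close>
      have avoid: "(f ^^ s) x \<noteq> x" if "1 \<le> s" "s \<le> t" for s
      proof
        assume "(f ^^ s) x = x"
        then have "y = (f ^^ (t - s)) x"
          using t that by (metis funpow_add comp_apply le_add_diff_inverse2)
        then show False
          using least[of "t - s"] that by simp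
      qed
      have "s \<le> t \<Longrightarrow> (f x, (f ^^ s) x) \<in> ?R\<^sup>*" if "1 \<le> s" for s
        using that
      proof (induction s rule: nat_induct_at_least)
        case (Suc s)
        have "{(f ^^ s) x, (f ^^ Suc s) x} \<in> {e \<in> F. x \<notin> e}"
          using it[OF x, of s] avoid[of s] avoid[of "Suc s"] Suc by (auto simp: F_def)
        with Suc show ?case
          by (auto intro: rtrancl_into_rtrancl)
      qed simp
      moreover have "1 \<le> t"
        using t y by (cases t) auto
      ultimately show ?thesis
        using t by blast
    qed
    have "sym ?R"
      by (auto simp: sym_def insert_commute)
    then have "sym (?R\<^sup>*)"
      by (rule sym_rtrancl)
    then have "(y, z) \<in> ?R\<^sup>*" if "y \<in> W - {x}" "z \<in> W - {x}" for y z
      using reach[OF that(1)] reach[OF that(2)] by (meson rtrancl_trans symD)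
    then have "card (components (W - {x}) {e \<in> F. x \<notin> e}) \<le> 1"
      by (intro card_components_connected) (auto simp: joined_def)
    with gt ne show False
      by linarith
  qed
  show "connected_without_cutpoints W F"
    using conW cut by (auto simp: connected_without_cutpoints_def)
qed

section \<open>Clique matchings\<close>

lemma clique_matching_insert:
  assumes "clique_matching V E Q" "C \<subseteq> V" "clique C E" "card C \<ge> 2" "C \<inter> \<Union>Q = {}"
  shows "clique_matching V E (insert C Q)"
  using assms unfolding clique_matching_def disjoint_def by blast

lemma clique_matching_of_injection:
  fixes f :: "'v \<Rightarrow> 'v"
  assumes bg: "block_graph V E" and "D \<subseteq> V" "inj_on f D" "\<And>v. v \<in> D \<Longrightarrow> {v, f v} \<in> E"
  shows "\<exists>Q. clique_matching V E Q \<and> \<Union>Q \<subseteq> D \<union> f ` D \<and> card D \<le> card (\<Union>Q)"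
  using assms(2-)
proof (induction "card D" arbitrary: D rule: less_induct)
  case less
  have finV: "finite V" and E: "\<And>e. e \<in> E \<Longrightarrow> e \<subseteq> V \<and> card e = 2"
    using bg by (auto simp: block_graph_def simple_graph_def)
  have finD: "finite D"
    using finV less.prems(1) finite_subset by blast
  have step: ?case if C: "C \<subseteq> D \<union> f ` D" "clique C E" "card C \<ge> 2" "C \<inter> D \<noteq> {}"
    and img: "C \<inter> f ` (D - C) = {}" for C
  proof -
    have "card (D - C) < card D"
      using finD C(4) by (intro psubset_card_mono) auto
    then obtain Q where Q: "clique_matching V E Q" "\<Union>Q \<subseteq> (D - C) \<union> f ` (D - C)"
      "card (D - C) \<le> card (\<Union>Q)"
      using less.hyps[of "D - C"] less.prems by (metis DiffD1 Diff_subset inj_on_subset subset_trans)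
    have "C \<subseteq> V"
      using C(1) less.prems(1,3) E by blast
    have disj: "C \<inter> \<Union>Q = {}"
      using Q(2) img by blast
    have "\<Union>Q \<subseteq> V"
      using Q(1) by (auto simp: clique_matching_def)
    then have "card (\<Union>(insert C Q)) = card C + card (\<Union>Q)"
      using disj finV \<open>C \<subseteq> V\<close> by (simp add: card_Un_disjoint finite_subset)
    moreover have "card D \<le> card C + card (D - C)"
      using card_Un_le[of C "D - C"] card_mono[of "C \<union> (D - C)" D] finD finV \<open>C \<subseteq> V\<close>
      by (simp add: finite_subset)
    moreover have "\<Union>(insert C Q) \<subseteq> D \<union> f ` D"
      using C(1) Q(2) by auto
    ultimately show ?thesis
      using clique_matching_insert[OF Q(1) \<open>C \<subseteq> V\<close> C(2,3) disj] Q(3)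
      by (intro exI[of _ "insert C Q"]) linarith
  qed
  consider "D = {}" | v where "v \<in> D" "v \<notin> f ` D" | "D \<noteq> {}" "D \<subseteq> f ` D"
    by blast
  then show ?case
  proof cases
    case 1
    then show ?thesis
      by (intro exI[of _ "{}"]) (auto simp: clique_matching_def)
  next
    \<comment> \<open>Here \<open>v\<close> starts a path: it is no image at all, and by injectivity
      \<open>f v\<close> is the image of \<open>v\<close> only. Thus the edge
      \<open>{v, f v}\<close> can be removed even when \<open>f v\<close> lies outside
      \<open>D\<close>.\<close>
    case (2 v)
    show ?thesis
    proof (rule step[of "{v, f v}"])
      show "clique {v, f v} E"
        using less.prems(3)[OF 2(1)] by (auto simp: clique_def insert_commute)
      show "{v, f v} \<inter> f ` (D - {v, f v}) = {}"
        using 2 less.prems(2) by (auto dest: inj_onD)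
    qed (use 2 E less.prems(3) in auto)
  next
    case 3
    have "card (f ` D) = card D"
      using less.prems(2) by (rule card_image)
    with 3 finD have fD: "f ` D = D"
      by (metis card_subset_eq finite_imageI)
    \<comment> \<open>Now \<open>f\<close> permutes \<open>D\<close>; a minimal nonempty set mapped
      into itself is a single cycle of this permutation.\<close>
    define S where "S = {S. S \<subseteq> D \<and> S \<noteq> {} \<and> f ` S \<subseteq> S}"
    have "finite S" "D \<in> S"
      using finD 3 fD by (auto simp: S_def)
    then obtain C where C: "C \<in> S" "\<And>C'. C' \<in> S \<Longrightarrow> C' \<subseteq> C \<Longrightarrow> C' = C"
      using finite_has_minimal2[of S D] by metis
    then have CD: "C \<subseteq> D" "C \<noteq> {}" "f ` C \<subseteq> C"
      by (auto simp: S_def)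
    have "finite C"
      using CD(1) finD finite_subset by blast
    then have fC: "f ` C = C"
      using CD less.prems(2) by (intro endo_inj_surj) (auto intro: inj_on_subset)
    have "clique C E"
    proof (rule cycle_clique[OF bg])
      fix x y assume xy: "x \<in> C" "y \<in> C"
      have "(f ^^ t) x \<in> C" for t
        using xy(1) CD(3) by (induction t) auto
      moreover have "f ((f ^^ t) x) \<in> range (\<lambda>t. (f ^^ t) x)" for t
        by (rule range_eqI[of _ _ "Suc t"]) simp
      \<comment> \<open>The orbit of \<open>x\<close> is itself mapped into itself by
        \<open>f\<close>, so minimality makes it all of \<open>C\<close>.\<close>
      ultimately have "range (\<lambda>t. (f ^^ t) x) = C"
        using CD(1) by (intro C(2)) (auto simp: S_def)
      with xy show "\<exists>t. y = (f ^^ t) x"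
        by auto
    qed (use CD less.prems in auto)
    obtain v where "v \<in> C"
      using CD by blast
    then have "{v, f v} \<subseteq> C" "card {v, f v} = 2"
      using CD E less.prems(3) by blast+
    then have "2 \<le> card C"
      using \<open>finite C\<close> card_mono by metis
    moreover have "C \<inter> f ` (D - C) = {}"
    proof -
      have "f ` C \<inter> f ` (D - C) = {}"
        using less.prems(2) CD(1) by (auto dest: inj_onD)
      then show ?thesis
        by (simp add: fC)
    qed
    ultimately show ?thesis
      using CD \<open>clique C E\<close> by (intro step[of C]) auto
  qed
qed

lemma clique_matching_number_attained:
  assumes "finite V"
  shows "clique_matching V E Q \<Longrightarrow> card (\<Union>Q) \<le> clique_matching_number V E"
    and "\<exists>Q. clique_matching V E Q \<and> card (\<Union>Q) = clique_matching_number V E"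
proof -
  let ?S = "{card (\<Union>Q) | Q. clique_matching V E Q}"
  have "?S \<subseteq> {..card V}"
    using assms by (auto simp: clique_matching_def intro!: card_mono)
  then have fin: "finite ?S"
    using finite_subset by blast
  then show "clique_matching V E Q \<Longrightarrow> card (\<Union>Q) \<le> clique_matching_number V E"
    unfolding clique_matching_number_def by (intro Max_ge) auto
  have "clique_matching V E {}"
    by (simp add: clique_matching_def)
  then have "clique_matching_number V E \<in> ?S"
    unfolding clique_matching_number_def using fin by (intro Max_in) blast+
  then show "\<exists>Q. clique_matching V E Q \<and> card (\<Union>Q) = clique_matching_number V E"
    by auto
qed

text \<open>Hall's deficiency version for the neighbourhoods yields \<open>A\<close> with
  neighbourhood \<open>M\<close> and an injection on \<open>D\<close>, hence a clique matching
  covering at least \<open>card D\<close> vertices. Removing \<open>A \<inter> M\<close> from both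
  \<open>A\<close> and \<open>M\<close> keeps the difference of their sizes and makes
  \<open>A\<close> independent.\<close>

lemma block_graph_independent_set:
  assumes bg: "block_graph V E"
  shows "\<exists>I\<subseteq>V. I \<inter> {w. \<exists>u\<in>I. {u, w} \<in> E} = {}
    \<and> card V + card {w. \<exists>u\<in>I. {u, w} \<in> E} \<le> card I + clique_matching_number V E"
proof -
  define N where "N u = {w. {u, w} \<in> E}" for u
  have finV: "finite V" and NV: "N u \<subseteq> V" for u
    using bg by (auto simp: block_graph_def simple_graph_def N_def)
  obtain f D A where D: "D \<subseteq> V" "inj_on f D" "\<forall>a\<in>D. f a \<in> N a" and "A \<subseteq> V"
    and le: "card V + card (\<Union>(N ` A)) \<le> card A + card D"
    using hall_deficiency[of V N] finV NV finite_subset by metis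
  obtain Q where "clique_matching V E Q" "card D \<le> card (\<Union>Q)"
    using clique_matching_of_injection[OF bg D(1,2)] D(3) by (auto simp: N_def)
  then have b: "card D \<le> clique_matching_number V E"
    using clique_matching_number_attained(1)[OF finV] order_trans by blast
  define M where "M = \<Union>(N ` A)"
  define I where "I = A - M"
  have fin: "finite A" "finite M"
    using \<open>A \<subseteq> V\<close> NV finV by (auto simp: M_def intro: finite_subset)
  \<comment> \<open>A neighbour of \<open>u \<in> I\<close> that lay in \<open>A\<close> would put
    \<open>u\<close> into \<open>M\<close>.\<close>
  have NI: "{w. \<exists>u\<in>I. {u, w} \<in> E} \<subseteq> M - A"
    by (auto simp: I_def M_def N_def insert_commute)
  then have "card {w. \<exists>u\<in>I. {u, w} \<in> E} \<le> card (M - A)"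
    using fin by (simp add: card_mono)
  also have "card (M - A) + card (A \<inter> M) = card M"
    using fin by (metis Int_commute card_Diff_subset_Int card_mono finite_Int inf_le1 le_add_diff_inverse2)
  moreover have "card I + card (A \<inter> M) = card A"
    using fin unfolding I_def by (metis card_Diff_subset_Int card_mono finite_Int inf_le1 le_add_diff_inverse2)
  ultimately have "card V + card {w. \<exists>u\<in>I. {u, w} \<in> E} \<le> card I + clique_matching_number V E"
    using le b unfolding M_def by linarith
  moreover have "I \<inter> {w. \<exists>u\<in>I. {u, w} \<in> E} = {}"
    using NI by (auto simp: I_def)
  ultimately show ?thesis
    using \<open>A \<subseteq> V\<close> by (intro exI[of _ I]) (auto simp: I_def)
qed

section \<open>Ideals and monomials\<close>

global_interpretation self_module: module "(*) :: 'a::comm_ring_1 \<Rightarrow> 'a \<Rightarrow> 'a"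
  by unfold_locales (simp_all add: algebra_simps)

lemma ideal_base: "a \<in> A \<Longrightarrow> a \<in> ideal A"
  unfolding ideal_def by (rule self_module.span_base)

lemma ideal_add: "p \<in> ideal A \<Longrightarrow> q \<in> ideal A \<Longrightarrow> p + q \<in> ideal A"
  unfolding ideal_def by (rule self_module.span_add)

lemma ideal_mult: "p \<in> ideal A \<Longrightarrow> c * p \<in> ideal A"
  unfolding ideal_def by (rule self_module.span_scale)

lemma ideal_sum_ideal: "ideal_sum (ideal A) (ideal B) = ideal (A \<union> B)"
  by (simp add: ideal_sum_def ideal_def self_module.span_Un)

lemma ideal_induct [consumes 1, case_names zero step]:
  assumes "p \<in> ideal A" "P 0" "\<And>c a q. a \<in> A \<Longrightarrow> P q \<Longrightarrow> P (c * a + q)"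
  shows "P p"
  using assms(1) unfolding ideal_def
  by (induction rule: self_module.span_induct_alt) (use assms in auto)

definition mon :: "('v var \<Rightarrow>\<^sub>0 nat) \<Rightarrow> ('v, 'k::field) mpoly" where
  "mon e = Poly_Mapping.single e 1"

lemma mon_add: "mon (e + f) = mon e * mon f"
  by (simp add: mon_def Poly_Mapping.mult_single)

lemma var_eq_mon: "var z = mon (Poly_Mapping.single z 1)"
  by (simp add: var_def mon_def)

lemma var_power: "var z ^ k = mon (Poly_Mapping.single z k)"
proof (induction k)
  case 0
  then show ?case
    by (simp add: mon_def)
next
  case (Suc k)
  have "Poly_Mapping.single z (Suc k) = Poly_Mapping.single z 1 + Poly_Mapping.single z k"
    by (simp flip: single_add)
  with Suc show ?case
    by (simp add: mon_add var_eq_mon)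
qed

text \<open>Coefficients enter as constant polynomials \<open>Poly_Mapping.single 0 c\<close>, so
  each summand is a ring multiple of a monomial, as ideal membership requires.\<close>

lemma mpoly_eq_sum_mon: "p = (\<Sum>e\<in>Poly_Mapping.keys p. Poly_Mapping.single 0 (Poly_Mapping.lookup p e) * mon e)"
  by (rule poly_mapping_eqI)
     (simp add: lookup_sum mon_def Poly_Mapping.mult_single lookup_single when_def in_keys_iff)

text \<open>Subtraction of exponent vectors is truncated; the bound on \<open>n\<close> makes it
  exact.\<close>

lemma single_diff_add:
  fixes e :: "'a \<Rightarrow>\<^sub>0 nat"
  assumes "n \<le> Poly_Mapping.lookup e z"
  shows "(e - Poly_Mapping.single z n) + Poly_Mapping.single z n = e"
  using assms by (intro poly_mapping_eqI) (auto simp: lookup_add lookup_minus lookup_single when_def)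

lemma mon_eq_mult_var_power:
  assumes "n \<le> Poly_Mapping.lookup e z"
  shows "mon e = mon (e - Poly_Mapping.single z n) * var z ^ n"
  by (simp only: var_power mon_add[symmetric] single_diff_add[OF assms])

section \<open>Degrees and powers of the maximal ideal\<close>

definition deg :: "('v::finite var \<Rightarrow>\<^sub>0 nat) \<Rightarrow> nat" where
  "deg e = (\<Sum>v\<in>UNIV. Poly_Mapping.lookup e (X v) + Poly_Mapping.lookup e (Y v))"

lemma deg_add: "deg (e + f) = deg e + deg f"
  by (simp add: deg_def lookup_add sum.distrib)

lemma deg_single: "deg (Poly_Mapping.single z n) = n"
  by (cases z) (simp_all add: deg_def lookup_single when_def)

lemma deg_pos:
  assumes "deg e > 0" shows "\<exists>z. Poly_Mapping.lookup e z > 0"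
  using assms by (rule contrapos_pp) (simp add: deg_def)

lemma keys_max_ideal_power:
  fixes p :: "('v::finite, 'k::field) mpoly"
  assumes "p \<in> ideal_power max_ideal r" "e \<in> Poly_Mapping.keys p"
  shows "r \<le> deg e"
  using assms
proof (induction r arbitrary: p e)
  case (Suc r)
  \<comment> \<open>A lower bound for the degrees of the terms of all generators passes to the whole
    ideal, since multiplication only raises degrees and addition creates no new exponents.\<close>
  have ideal_le: "m \<le> deg e"
    if "q \<in> ideal A" "\<And>a e. a \<in> A \<Longrightarrow> e \<in> Poly_Mapping.keys a \<Longrightarrow> m \<le> deg e" "e \<in> Poly_Mapping.keys q"
    for q :: "('v, 'k) mpoly" and A m e
    using that(1,3)
  proof (induction arbitrary: e rule: ideal_induct)
    case (step c a q)
    from step.prems consider "e \<in> Poly_Mapping.keys q" | "e \<in> Poly_Mapping.keys (c * a)"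
      using keys_add[of "c * a" q] by blast
    then show ?case
    proof cases
      case 2
      then obtain e1 e2 where "e = e1 + e2" "e2 \<in> Poly_Mapping.keys a"
        using 2 keys_mult[of c a] by blast
      then show ?thesis
        using that(2)[OF step.hyps] by (simp add: deg_add trans_le_add2)
    qed (rule step.IH)
  qed simp
  have one: "1 \<le> deg e" if "q \<in> max_ideal" "e \<in> Poly_Mapping.keys q" for q :: "('v, 'k) mpoly" and e
    by (rule ideal_le[OF that(1)[unfolded max_ideal_def] _ that(2)])
       (auto simp: var_eq_mon mon_def deg_single)
  show ?case
  proof (rule ideal_le[OF Suc.prems(1)[simplified] _ Suc.prems(2)])
    fix a :: "('v, 'k) mpoly" and e
    assume "a \<in> {a * b |a b. a \<in> max_ideal \<and> b \<in> ideal_power max_ideal r}" "e \<in> Poly_Mapping.keys a"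
    then obtain b c :: "('v, 'k) mpoly" where bc: "b \<in> max_ideal" "c \<in> ideal_power max_ideal r"
      and "e \<in> Poly_Mapping.keys (b * c)"
      by blast
    then obtain e1 e2 where "e = e1 + e2" "e1 \<in> Poly_Mapping.keys b" "e2 \<in> Poly_Mapping.keys c"
      using keys_mult[of b c] by blast
    with bc show "Suc r \<le> deg e"
      using one Suc.IH by (fastforce simp: deg_add)
  qed
qed simp

lemma mon_in_max_ideal_power: "(mon e :: ('v::finite, 'k::field) mpoly) \<in> ideal_power max_ideal (deg e)"
proof (induction "deg e" arbitrary: e)
  case 0
  then show ?case
    by (metis UNIV_I ideal_power.simps(1))
next
  case (Suc r)
  then obtain z where "Poly_Mapping.lookup e z > 0"
    using deg_pos by (metis zero_less_Suc)
  then have e: "(e - Poly_Mapping.single z 1) + Poly_Mapping.single z 1 = e"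
    by (intro single_diff_add) simp
  then have "deg (e - Poly_Mapping.single z 1) = r"
    using Suc.hyps(2) deg_add deg_single by (metis add_right_cancel Suc_eq_plus1)
  then have "mon (e - Poly_Mapping.single z 1) \<in> ideal_power (max_ideal :: ('v, 'k) mpoly set) r"
    using Suc.hyps(1) by metis
  moreover have "(var z :: ('v, 'k) mpoly) \<in> max_ideal"
    unfolding max_ideal_def by (rule ideal_base) simp
  moreover have "(mon e :: ('v, 'k) mpoly) = var z * mon (e - Poly_Mapping.single z 1)"
    unfolding var_eq_mon mon_add[symmetric] by (simp only: e add.commute[of "Poly_Mapping.single z 1"])
  ultimately have "(mon e :: ('v, 'k) mpoly) \<in> ideal_power max_ideal (Suc r)"
    unfolding ideal_power.simps by (intro ideal_base) blast
  then show ?case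
    using Suc.hyps(2) by metis
qed

lemma max_ideal_power_subset_iff:
  "ideal_power (max_ideal :: ('v::finite, 'k::field) mpoly set) r \<subseteq> ideal G
    \<longleftrightarrow> (\<forall>e. r \<le> deg e \<longrightarrow> (mon e :: ('v, 'k) mpoly) \<in> ideal G)" (is "?L \<longleftrightarrow> ?R")
proof
  \<comment> \<open>The powers decrease, so monomials of degree above \<open>r\<close> also lie in
    the \<open>r\<close>-th power.\<close>
  have anti: "ideal_power (max_ideal :: ('v, 'k) mpoly set) (r + s) \<subseteq> ideal_power max_ideal r" for s r
  proof (induction r)
    case (Suc r)
    have "{a * b |a b. a \<in> max_ideal \<and> b \<in> ideal_power max_ideal (r + s)}
      \<subseteq> {a * b |a b. a \<in> (max_ideal :: ('v, 'k) mpoly set) \<and> b \<in> ideal_power max_ideal r}"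
      using Suc by blast
    then show ?case
      unfolding add_Suc ideal_power.simps ideal_def by (rule self_module.span_mono)
  qed simp
  show "?L \<Longrightarrow> ?R"
    using anti[of r] mon_in_max_ideal_power by (metis le_add_diff_inverse subsetD)
  assume R: ?R
  show ?L
  proof
    fix p :: "('v, 'k) mpoly" assume "p \<in> ideal_power max_ideal r"
    then have "mon e \<in> ideal G" if "e \<in> Poly_Mapping.keys p" for e
      using keys_max_ideal_power that R by blast
    then have "(\<Sum>e\<in>Poly_Mapping.keys p. Poly_Mapping.single 0 (Poly_Mapping.lookup p e) * mon e) \<in> ideal G"
      unfolding ideal_def by (intro self_module.span_sum self_module.span_scale)
    then show "p \<in> ideal G"
      using mpoly_eq_sum_mon[of p] by simp
  qed
qed

section \<open>Monomials inside the ideal\<close>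

text \<open>Modulo the binomials, a factor \<open>var (P j)\<close> can be exchanged for \<open>var (P i)\<close> at the cost of
  exchanging \<open>var (Q i)\<close> for \<open>var (Q j)\<close>. This is repeated until \<open>var (P i)\<close> has exponent \<open>k\<close>.\<close>

lemma mon_in_ideal_gather:
  fixes P Q :: "'v \<Rightarrow> 'v var" and G :: "('v, 'k::field) mpoly set"
  assumes "inj P" "\<And>i j. P i \<noteq> Q j"
    and pow: "\<And>z. var z ^ k \<in> ideal G"
    and rel: "\<And>j. j \<in> C \<Longrightarrow> j \<noteq> i \<Longrightarrow> var (P j) * var (Q i) - var (P i) * var (Q j) \<in> ideal G"
    and "finite C" "i \<in> C"
    and "k \<le> Poly_Mapping.lookup e (P i) + Poly_Mapping.lookup e (Q i)" "k \<le> (\<Sum>j\<in>C. Poly_Mapping.lookup e (P j))"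
  shows "mon e \<in> ideal G"
  using assms(7,8)
proof (induction "k - Poly_Mapping.lookup e (P i)" arbitrary: e)
  case 0
  then show ?case
    by (simp add: mon_eq_mult_var_power[of k e "P i"] ideal_mult pow)
next
  case (Suc n)
  then have lt: "Poly_Mapping.lookup e (P i) < k"
    by simp
  have "\<exists>j\<in>C. j \<noteq> i \<and> Poly_Mapping.lookup e (P j) > 0"
  proof (rule ccontr)
    assume "\<not> ?thesis"
    then have "(\<Sum>j\<in>C. Poly_Mapping.lookup e (P j)) = (\<Sum>j\<in>{i}. Poly_Mapping.lookup e (P j))"
      using \<open>finite C\<close> \<open>i \<in> C\<close> by (intro sum.mono_neutral_right) auto
    with lt Suc.prems show False
      by simp
  qed
  then obtain j where j: "j \<in> C" "j \<noteq> i" "Poly_Mapping.lookup e (P j) > 0"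
    by blast
  \<comment> \<open>Both subtractions are exact: \<open>P j\<close> occurs by choice of
    \<open>j\<close>, and \<open>Q i\<close> occurs because the exponent of \<open>P i\<close> is
    below \<open>k\<close> while the exponents of \<open>P i\<close> and \<open>Q i\<close> sum to
    at least \<open>k\<close>.\<close>
  define e0 where "e0 = e - Poly_Mapping.single (P j) 1 - Poly_Mapping.single (Q i) 1"
  define e' where "e' = e0 + Poly_Mapping.single (P i) 1 + Poly_Mapping.single (Q j) 1"
  have sep: "P l \<noteq> Q m" "Q m \<noteq> P l" "P l = P m \<longleftrightarrow> l = m" for l m
    using assms(2)[of l m] inj_eq[OF assms(1)] by auto
  have "e0 + Poly_Mapping.single (Q i) 1 = e - Poly_Mapping.single (P j) 1"
    unfolding e0_def using lt Suc.prems(1) sep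
    by (intro single_diff_add) (simp add: lookup_minus lookup_single)
  moreover have "e - Poly_Mapping.single (P j) 1 + Poly_Mapping.single (P j) 1 = e"
    using j(3) by (intro single_diff_add) simp
  ultimately have e: "e = e0 + Poly_Mapping.single (Q i) 1 + Poly_Mapping.single (P j) 1"
    by simp
  have "Poly_Mapping.lookup e' (P i) = Suc (Poly_Mapping.lookup e (P i))"
    using j(2) by (simp add: e e'_def lookup_add lookup_single sep when_def)
  moreover from this have "n = k - Poly_Mapping.lookup e' (P i)"
    using Suc.hyps(2) by simp
  \<comment> \<open>The possible loss of one \<open>Q i\<close> is balanced by the gained
    \<open>P i\<close>. Only an inequality is stated because \<open>Q j\<close> and
    \<open>Q i\<close> may be the same variable, \<open>Q\<close> being arbitrary.\<close>
  moreover have "Suc (Poly_Mapping.lookup e' (Q i)) \<ge> Poly_Mapping.lookup e (Q i)"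
    by (simp add: e e'_def lookup_add lookup_single sep when_def)
  moreover have "(\<Sum>l\<in>C. Poly_Mapping.lookup e' (P l)) = (\<Sum>l\<in>C. Poly_Mapping.lookup e (P l))"
    using \<open>finite C\<close> \<open>i \<in> C\<close> \<open>j \<in> C\<close>
    by (simp add: e e'_def lookup_add lookup_single sep when_def sum.distrib)
  ultimately have "mon e' \<in> ideal G"
    using Suc.prems by (intro Suc.hyps(1)) linarith+
  moreover have "mon e = mon e0 * (var (P j) * var (Q i) - var (P i) * var (Q j)) + (mon e' :: ('v, 'k) mpoly)"
  proof -
    have "mon e = (mon e0 * (var (P j) * var (Q i)) :: ('v, 'k) mpoly)"
      unfolding e mon_add var_eq_mon by (simp only: mult.assoc mult.commute[of "mon (Poly_Mapping.single (Q i) 1)"])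
    moreover have "mon e' = (mon e0 * (var (P i) * var (Q j)) :: ('v, 'k) mpoly)"
      unfolding e'_def mon_add var_eq_mon by (simp only: mult.assoc)
    ultimately show ?thesis
      by (simp add: right_diff_distrib)
  qed
  ultimately show ?case
    by (simp add: ideal_add ideal_mult rel j(1,2))
qed

section \<open>Upper bound for the degree of a monomial outside the ideal\<close>

definition gens :: "nat \<Rightarrow> 'v set set \<Rightarrow> ('v, 'k::field) mpoly set" where
  "gens k E = range (\<lambda>z. var z ^ k)
     \<union> {var (X i) * var (Y j) - var (X j) * var (Y i) | i j. {i, j} \<in> E}"

lemma ideal_gens: "ideal_sum (frobenius_power k) (binomial_edge_ideal E) = ideal (gens k E)"
  by (simp add: frobenius_power_def binomial_edge_ideal_def gens_def ideal_sum_ideal)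

lemma edge_binomial_in_ideal:
  "{i, j} \<in> E \<Longrightarrow> var (X i) * var (Y j) - var (X j) * var (Y i) \<in> ideal (gens k E)"
  unfolding gens_def by (intro ideal_base) blast

text \<open>If the bound failed, some vertex \<open>i\<close> would have degree at least
  \<open>k\<close>. As \<open>card C \<ge> 2\<close>, the total would also exceed
  \<open>2 * (k - 1)\<close>, so the \<open>x\<close>'s or the \<open>y\<close>'s alone would have
  degree at least \<open>k\<close>; gathering these at \<open>i\<close> puts the monomial into the
  ideal.\<close>

lemma clique_degree_le:
  fixes e :: "'v var \<Rightarrow>\<^sub>0 nat"
  assumes notin: "mon e \<notin> ideal (gens k E :: ('v, 'k::field) mpoly set)"
    and C: "clique C E" "card C \<ge> 2"
  shows "(\<Sum>v\<in>C. Poly_Mapping.lookup e (X v) + Poly_Mapping.lookup e (Y v)) \<le> card C * (k - 1)"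
proof (rule ccontr)
  assume "\<not> ?thesis"
  then have gt: "card C * (k - 1) < (\<Sum>v\<in>C. Poly_Mapping.lookup e (X v) + Poly_Mapping.lookup e (Y v))"
    by simp
  have "finite C"
    using C(2) by (metis card.infinite not_numeral_le_zero)
  have "\<exists>i\<in>C. k - 1 < Poly_Mapping.lookup e (X i) + Poly_Mapping.lookup e (Y i)"
  proof (rule ccontr)
    assume "\<not> ?thesis"
    then have "(\<Sum>v\<in>C. Poly_Mapping.lookup e (X v) + Poly_Mapping.lookup e (Y v)) \<le> of_nat (card C) * (k - 1)"
      by (intro sum_bounded_above) (auto simp: not_less)
    with gt show False
      by simp
  qed
  then obtain i where i: "i \<in> C" "k \<le> Poly_Mapping.lookup e (X i) + Poly_Mapping.lookup e (Y i)"
    by fastforce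
  have "2 * (k - 1) \<le> card C * (k - 1)"
    using C(2) by (rule mult_right_mono) simp
  from le_less_trans[OF this gt]
  have "2 * (k - 1) < (\<Sum>v\<in>C. Poly_Mapping.lookup e (X v)) + (\<Sum>v\<in>C. Poly_Mapping.lookup e (Y v))"
    by (simp only: sum.distrib)
  then consider "k \<le> (\<Sum>v\<in>C. Poly_Mapping.lookup e (X v))" | "k \<le> (\<Sum>v\<in>C. Poly_Mapping.lookup e (Y v))"
    by linarith
  moreover have pow: "var z ^ k \<in> ideal (gens k E :: ('v, 'k) mpoly set)" for z
    by (intro ideal_base) (auto simp: gens_def)
  have edge: "{i, j} \<in> E" if "j \<in> C" "j \<noteq> i" for j
    using C(1) i(1) that by (auto simp: clique_def)
  have relX: "var (X j) * var (Y i) - var (X i) * var (Y j) \<in> ideal (gens k E :: ('v, 'k) mpoly set)"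
    if "j \<in> C" "j \<noteq> i" for j
    by (rule edge_binomial_in_ideal) (use edge[OF that] in \<open>simp add: insert_commute\<close>)
  \<comment> \<open>For gathering the \<open>y\<close>'s the two kinds of variables swap roles; the
    edge binomial takes the required shape once its factors are commuted.\<close>
  have relY: "var (Y j) * var (X i) - var (Y i) * var (X j) \<in> ideal (gens k E :: ('v, 'k) mpoly set)"
    if "j \<in> C" "j \<noteq> i" for j
    using edge_binomial_in_ideal[OF edge[OF that], where 'b = 'k] by (simp only: mult.commute)
  ultimately have "mon e \<in> ideal (gens k E :: ('v, 'k) mpoly set)"
  proof cases
    case 1
    show ?thesis
      by (rule mon_in_ideal_gather[OF _ _ pow relX \<open>finite C\<close> i 1]) (auto simp: inj_def)
  next
    case 2
    show ?thesis
      by (rule mon_in_ideal_gather[OF _ _ pow relY \<open>finite C\<close> i(1) _ 2]) (use i in \<open>auto simp: inj_def\<close>)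
  qed
  with notin show False ..
qed

lemma lookup_less_of_notin:
  assumes "mon e \<notin> ideal (gens k E :: ('v, 'k::field) mpoly set)"
  shows "Poly_Mapping.lookup e z < k"
proof (rule ccontr)
  assume "\<not> ?thesis"
  then have "mon e = mon (e - Poly_Mapping.single z k) * (var z ^ k :: ('v, 'k) mpoly)"
    by (intro mon_eq_mult_var_power) simp
  moreover have "var z ^ k \<in> ideal (gens k E :: ('v, 'k) mpoly set)"
    by (intro ideal_base) (auto simp: gens_def)
  ultimately show False
    using assms ideal_mult by metis
qed

text \<open>A vertex outside the matching has two exponents of at most \<open>k - 1\<close> each,
  while cliques average \<open>k - 1\<close> per vertex. So each covered vertex lowers the bound by
  \<open>k - 1\<close>.\<close>

lemma degree_le_of_notin:
  fixes e :: "'v::finite var \<Rightarrow>\<^sub>0 nat"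
  assumes notin: "mon e \<notin> ideal (gens k E :: ('v, 'k::field) mpoly set)"
    and Q: "clique_matching UNIV E Q"
  shows "deg e \<le> (2 * CARD('v) - card (\<Union>Q)) * (k - 1)"
proof -
  let ?d = "\<lambda>v. Poly_Mapping.lookup e (X v) + Poly_Mapping.lookup e (Y v)"
  have "(\<Sum>v\<in>\<Union>Q. ?d v) = (\<Sum>C\<in>Q. \<Sum>v\<in>C. ?d v)"
    using Q by (subst sum.Union_disjoint) (auto simp: clique_matching_def disjoint_def)
  also have "\<dots> \<le> (\<Sum>C\<in>Q. card C * (k - 1))"
    using Q clique_degree_le[OF notin] by (intro sum_mono) (auto simp: clique_matching_def)
  also have "\<dots> = card (\<Union>Q) * (k - 1)"
    using Q by (subst card_Union_disjoint)
      (auto simp: clique_matching_def pairwise_def disjnt_def disjoint_def sum_distrib_right)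
  finally have 1: "(\<Sum>v\<in>\<Union>Q. ?d v) \<le> card (\<Union>Q) * (k - 1)" .
  have "?d v \<le> 2 * (k - 1)" for v
    using lookup_less_of_notin[OF notin, of "X v"] lookup_less_of_notin[OF notin, of "Y v"] by linarith
  then have "(\<Sum>v\<in>- \<Union>Q. ?d v) \<le> of_nat (card (- \<Union>Q)) * (2 * (k - 1))"
    by (intro sum_bounded_above) auto
  moreover have "card (- \<Union>Q) = CARD('v) - card (\<Union>Q)"
    by (simp add: Compl_eq_Diff_UNIV card_Diff_subset)
  moreover have "deg e = (\<Sum>v\<in>\<Union>Q. ?d v) + (\<Sum>v\<in>- \<Union>Q. ?d v)"
    unfolding deg_def by (subst sum.union_disjoint[symmetric]) auto
  ultimately have "deg e \<le> card (\<Union>Q) * (k - 1) + (CARD('v) - card (\<Union>Q)) * (2 * (k - 1))"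
    using 1 by simp
  also have "\<dots> = (card (\<Union>Q) + 2 * (CARD('v) - card (\<Union>Q))) * (k - 1)"
    by (simp only: add_mult_distrib add_mult_distrib2 ac_simps)
  also have "card (\<Union>Q) + 2 * (CARD('v) - card (\<Union>Q)) = 2 * CARD('v) - card (\<Union>Q)"
    using card_mono[of UNIV "\<Union>Q"] by simp
  finally show ?thesis .
qed

section \<open>Monomials outside the ideal\<close>

text \<open>The sum of the coefficients at exponents in \<open>T\<close> is a linear functional that vanishes on the ideal.\<close>

lemma mon_notin_ideal:
  fixes T :: "('v var \<Rightarrow>\<^sub>0 nat) set"
  assumes less: "\<And>e z. e \<in> T \<Longrightarrow> Poly_Mapping.lookup e z < k"
    and move: "\<And>e i j. {i, j} \<in> E \<Longrightarrow> e + Poly_Mapping.single (X i) 1 + Poly_Mapping.single (Y j) 1 \<in> T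
      \<Longrightarrow> e + Poly_Mapping.single (X j) 1 + Poly_Mapping.single (Y i) 1 \<in> T"
    and "e0 \<in> T"
  shows "mon e0 \<notin> ideal (gens k E :: ('v, 'k::field) mpoly set)"
proof
  define \<phi> :: "('v, 'k) mpoly \<Rightarrow> 'k" where
    "\<phi> p = (\<Sum>e\<in>Poly_Mapping.keys p. if e \<in> T then Poly_Mapping.lookup p e else 0)" for p
  have add: "\<phi> (p + q) = \<phi> p + \<phi> q" for p q
    unfolding \<phi>_def by (rule setsum_keys_plus_distrib) auto
  have sum: "\<phi> (\<Sum>x\<in>B. h x) = (\<Sum>x\<in>B. \<phi> (h x))" for h and B :: "('v var \<Rightarrow>\<^sub>0 nat) set"
    by (induction B rule: infinite_finite_induct) (auto simp: add \<phi>_def[of 0])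
  have single: "\<phi> (Poly_Mapping.single e c) = (if e \<in> T then c else 0)" for e c
    by (simp add: \<phi>_def)
  have mon0: "\<phi> (Poly_Mapping.single e c * g) = 0" if "g \<in> gens k E" for e c g
    using that unfolding gens_def
  proof (elim UnE rangeE CollectE exE conjE)
    fix z assume "g = var z ^ k"
    moreover have "e + Poly_Mapping.single z k \<notin> T"
      using less[of "e + Poly_Mapping.single z k" z] by (auto simp: lookup_add)
    ultimately show ?thesis
      by (simp add: var_power mon_def Poly_Mapping.mult_single single)
  next
    fix i j assume g: "g = var (X i) * var (Y j) - var (X j) * var (Y i)" and "{i, j} \<in> E"
    let ?e = "e + Poly_Mapping.single (X i) 1 + Poly_Mapping.single (Y j) 1"
      and ?f = "e + Poly_Mapping.single (X j) 1 + Poly_Mapping.single (Y i) 1"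
    \<comment> \<open>An edge has no direction, so \<open>move\<close> applies with its ends in
      either order and yields an equivalence; the two terms of the binomial then cancel under
      \<open>\<phi>\<close>.\<close>
    have "?e \<in> T \<longleftrightarrow> ?f \<in> T"
      using move[of i j e] move[of j i e] \<open>{i, j} \<in> E\<close> insert_commute[of i j "{}"] by auto
    moreover have "Poly_Mapping.single e c * (var z * var w)
        = Poly_Mapping.single (e + Poly_Mapping.single z 1 + Poly_Mapping.single w 1) c" for z w
      by (simp only: var_eq_mon mon_def Poly_Mapping.mult_single add.assoc mult_1_right)
    then have "Poly_Mapping.single e c * g = Poly_Mapping.single ?e c + Poly_Mapping.single ?f (- c)"
      by (simp only: g right_diff_distrib single_uminus add_uminus_conv_diff)
    ultimately show ?thesis
      by (simp only: add single) simp
  qed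
  have gen0: "\<phi> (p * g) = 0" if "g \<in> gens k E" for p g
  proof -
    have "(\<Sum>e\<in>Poly_Mapping.keys p. Poly_Mapping.single e (Poly_Mapping.lookup p e)) = p"
      using mpoly_eq_sum_mon[of p, symmetric]
      by (simp only: mon_def Poly_Mapping.mult_single add_0 mult_1_right)
    then have "p * g = (\<Sum>e\<in>Poly_Mapping.keys p. Poly_Mapping.single e (Poly_Mapping.lookup p e) * g)"
      by (simp only: sum_distrib_right[symmetric])
    then show ?thesis
      by (simp only: sum mon0[OF that] sum.neutral_const)
  qed
  assume "mon e0 \<in> ideal (gens k E :: ('v, 'k) mpoly set)"
  then have "\<phi> (mon e0) = 0"
    by (induction rule: ideal_induct) (auto simp: add gen0 \<phi>_def[of 0])
  with \<open>e0 \<in> T\<close> show False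
    by (simp add: mon_def single)
qed

text \<open>Moves need a positive exponent at both ends of an edge, hence avoid \<open>N\<close>,
  and therefore also \<open>I\<close>, all of whose neighbours are in \<open>N\<close>. At any other
  vertex a move trades an \<open>x\<close> for a \<open>y\<close> or conversely, which keeps its
  degree \<open>k - 1\<close>.\<close>

lemma independent_set_mon:
  fixes E :: "'v::finite set set"
  assumes "I \<inter> {w. \<exists>u\<in>I. {u, w} \<in> E} = {}" "\<And>e. e \<in> E \<Longrightarrow> card e = 2" "k \<ge> 1"
  shows "\<exists>e. mon e \<notin> ideal (gens k E :: ('v, 'k::field) mpoly set)
    \<and> deg e = (CARD('v) + card I - card {w. \<exists>u\<in>I. {u, w} \<in> E}) * (k - 1)"
proof -
  define N where "N = {w. \<exists>u\<in>I. {u, w} \<in> E}"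
  define T :: "('v var \<Rightarrow>\<^sub>0 nat) set" where "T = {e. (\<forall>v\<in>I. Poly_Mapping.lookup e (X v) = k - 1 \<and> Poly_Mapping.lookup e (Y v) = k - 1)
    \<and> (\<forall>v\<in>N. Poly_Mapping.lookup e (X v) = 0 \<and> Poly_Mapping.lookup e (Y v) = 0)
    \<and> (\<forall>v. v \<notin> I \<longrightarrow> v \<notin> N \<longrightarrow> Poly_Mapping.lookup e (X v) + Poly_Mapping.lookup e (Y v) = k - 1)}"
  have IN: "I \<inter> N = {}"
    using assms(1) by (simp add: N_def)
  \<comment> \<open>The member of \<open>T\<close> that spends the whole degree of the vertices
    outside \<open>I\<close> and \<open>N\<close> on their \<open>x\<close>'s.\<close>
  define e0 :: "'v var \<Rightarrow>\<^sub>0 nat" where "e0 = (\<Sum>v\<in>-N. Poly_Mapping.single (X v) (k - 1))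
    + (\<Sum>v\<in>I. Poly_Mapping.single (Y v) (k - 1))"
  have e0: "Poly_Mapping.lookup e0 (X v) = (if v \<in> N then 0 else k - 1)" "Poly_Mapping.lookup e0 (Y v) = (if v \<in> I then k - 1 else 0)" for v
    by (auto simp: e0_def lookup_add lookup_sum lookup_single when_def)
  have "e0 \<in> T"
    using IN by (auto simp: T_def e0)
  have "mon e0 \<notin> ideal (gens k E :: ('v, 'k) mpoly set)"
  proof (rule mon_notin_ideal[OF _ _ \<open>e0 \<in> T\<close>])
    fix e and z :: "'v var" assume e: "e \<in> T"
    obtain v where v: "z = X v \<or> z = Y v"
      by (cases z) auto
    consider "v \<in> I" | "v \<in> N" | "v \<notin> I" "v \<notin> N"
      by blast
    then have "Poly_Mapping.lookup e (X v) \<le> k - 1 \<and> Poly_Mapping.lookup e (Y v) \<le> k - 1"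
    proof cases
      case 3
      with e have "Poly_Mapping.lookup e (X v) + Poly_Mapping.lookup e (Y v) = k - 1"
        by (simp add: T_def)
      then show ?thesis
        by linarith
    qed (use e in \<open>auto simp: T_def\<close>)
    with v \<open>k \<ge> 1\<close> show "Poly_Mapping.lookup e z < k"
      by auto
  next
    fix e i j assume ij: "{i, j} \<in> E" and e: "e + Poly_Mapping.single (X i) 1 + Poly_Mapping.single (Y j) 1 \<in> T"
    let ?e = "e + Poly_Mapping.single (X i) 1 + Poly_Mapping.single (Y j) 1"
    have "Poly_Mapping.lookup ?e (X i) > 0" "Poly_Mapping.lookup ?e (Y j) > 0"
      by (simp_all add: lookup_add)
    then have "i \<notin> N" "j \<notin> N"
      using e by (auto simp: T_def)
    then have "i \<notin> I" "j \<notin> I"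
      using ij by (auto simp: N_def insert_commute)
    moreover have "i \<noteq> j"
      using assms(2)[OF ij] by auto
    ultimately show "e + Poly_Mapping.single (X j) 1 + Poly_Mapping.single (Y i) 1 \<in> T"
      using e \<open>i \<notin> N\<close> \<open>j \<notin> N\<close>
      by (auto simp: T_def lookup_add lookup_single when_def split: if_splits)
  qed
  moreover have "deg e0 = (card (- N) + card I) * (k - 1)"
    by (simp add: deg_def e0 sum.distrib sum.If_cases add_mult_distrib Collect_neg_eq)
  moreover have "card (- N) + card I = CARD('v) + card I - card N"
    by (simp add: Compl_eq_Diff_UNIV card_Diff_subset card_mono)
  ultimately show ?thesis
    unfolding N_def by metis
qed

section \<open>The exact value for block graphs and the limit\<close>

lemma v_number_block_graph:
  fixes E :: "'v::finite set set"
  assumes bg: "block_graph UNIV E" and k: "k \<ge> 1"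
  shows "v_number TYPE('k::field) E k = (2 * CARD('v) - clique_matching_number UNIV E) * (k - 1)"
proof -
  let ?b = "clique_matching_number UNIV E"
  let ?S = "{r. \<not> ideal_power (max_ideal :: ('v, 'k) mpoly set) r
               \<subseteq> ideal_sum (frobenius_power k) (binomial_edge_ideal E)}"
  obtain Q where Q: "clique_matching UNIV E Q" "card (\<Union>Q) = ?b"
    using clique_matching_number_attained(2)[OF finite[of UNIV], of E] by blast
  \<comment> \<open>In this form the set is downward closed, and its maximum is the largest degree
    of a monomial outside the ideal.\<close>
  have S: "?S = {r. \<exists>e. r \<le> deg e \<and> mon e \<notin> ideal (gens k E :: ('v, 'k) mpoly set)}"
    unfolding ideal_gens max_ideal_power_subset_iff by blast
  have ub: "deg e \<le> (2 * CARD('v) - ?b) * (k - 1)"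
    if "mon e \<notin> ideal (gens k E :: ('v, 'k) mpoly set)" for e
    using degree_le_of_notin[OF that Q(1)] Q(2) by simp
  obtain I where I: "I \<inter> {w. \<exists>u\<in>I. {u, w} \<in> E} = {}"
    "CARD('v) + card {w. \<exists>u\<in>I. {u, w} \<in> E} \<le> card I + ?b"
    using block_graph_independent_set[OF bg] by auto
  have "\<And>e. e \<in> E \<Longrightarrow> card e = 2"
    using bg by (auto simp: block_graph_def simple_graph_def)
  then obtain e where e: "mon e \<notin> ideal (gens k E :: ('v, 'k) mpoly set)"
    "deg e = (CARD('v) + card I - card {w. \<exists>u\<in>I. {u, w} \<in> E}) * (k - 1)"
    using independent_set_mon[OF I(1) _ k] by blast
  have "(2 * CARD('v) - ?b) * (k - 1) \<le> deg e"
    unfolding e(2) using I(2) by (intro mult_right_mono) linarith+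
  then have "(2 * CARD('v) - ?b) * (k - 1) \<in> ?S"
    unfolding S using e(1) by blast
  moreover have le: "r \<le> (2 * CARD('v) - ?b) * (k - 1)" if "r \<in> ?S" for r
    using that ub unfolding S by (auto intro: order_trans)
  moreover have "finite ?S"
    by (rule finite_subset[of _ "{..(2 * CARD('v) - ?b) * (k - 1)}"]) (use le in blast, simp)
  ultimately show ?thesis
    unfolding v_number_def by (intro Max_eqI)
qed

theorem theorem5p6:
  fixes E :: "'v::finite set set"
  assumes "block_graph UNIV E"
  shows "convergent (\<lambda>k. real (v_number TYPE('k::field) E k) / real k)
    \<and> diagonal_F_threshold TYPE('k) E
        = 2 * real CARD('v) - real (clique_matching_number UNIV E)"
proof -
  define c where "c = 2 * CARD('v) - clique_matching_number UNIV E"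
  obtain Q where "clique_matching UNIV E Q" "card (\<Union>Q) = clique_matching_number UNIV E"
    using clique_matching_number_attained(2)[OF finite[of UNIV], of E] by blast
  \<comment> \<open>This makes the truncated subtraction in \<open>c\<close> exact, so that it may
    be carried over to the reals.\<close>
  then have "clique_matching_number UNIV E \<le> CARD('v)"
    using card_mono[of UNIV "\<Union>Q"] by simp
  then have c: "real c = 2 * real CARD('v) - real (clique_matching_number UNIV E)"
    by (simp add: c_def)
  have "(\<lambda>k. real c - real c / real k) \<longlonglongrightarrow> real c - 0"
    by (intro tendsto_diff tendsto_const lim_const_over_n)
  moreover have "real c - real c / real k = real (v_number TYPE('k) E k) / real k" if "1 \<le> k" for k
  proof -
    have "v_number TYPE('k) E k = c * (k - 1)"
      unfolding c_def by (rule v_number_block_graph[OF assms that])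
    with that show ?thesis
      by (simp add: of_nat_diff field_simps)
  qed
  \<comment> \<open>At \<open>k = 0\<close> division gives 0 and the left side is
    \<open>real c\<close>, so the sequences are compared from \<open>k = 1\<close> on.\<close>
  then have "\<forall>\<^sub>F k in sequentially.
      real c - real c / real k = real (v_number TYPE('k) E k) / real k"
    using eventually_ge_at_top[of 1] by (rule eventually_mono[rotated])
  ultimately have "(\<lambda>k. real (v_number TYPE('k) E k) / real k) \<longlonglongrightarrow> real c"
    by (simp add: Lim_transform_eventually)
  then show ?thesis
    unfolding diagonal_F_threshold_def c[symmetric] by (auto intro: convergentI limI)
qed

end
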